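(* There exists a multiple unicast instance with three unit-entropy sessions and connectivity level $[2~2~2]$ that is infeasible, and there exists a multiple unicast instance with three unit-entropy sessions and connectivity level $[1~1~3]$ that is infeasible.
   Context: A network is a finite directed acyclic graph $G=(V,E)$ (parallel edges allowed) in which every edge has unit capacity. A multiple unicast instance with $n$ sessions consists of $G$ together with source nodes $s_1,\dots,s_n$ and terminal nodes $t_1,\dots,t_n$ in $V$; source nodes have no incoming edges and terminal nodes have no outgoing edges; different sources (or terminals) may be collocated at the same node. Each $s_i$ observes a unit-entropy message to be communicated to $t_i$. The connectivity level is the vector $[k_1~\dots~k_n]$ where $k_i$ is the maximum flow from $s_i$ to $t_i$ in $G$. Coding strategies (possibly nonlinear): for a finite alphabet $\mathcal{X}$ with $|\mathcal{X}|\ge 2$ and block length $T$, the unit-entropy messages are independent and uniformly distributed on $\mathcal{X}^T$; each edge carries an element of $\mathcal{X}^T$ which is an arbitrary function of what is carried on the incoming edges of its tail and of the messages observed at its tail; each terminal $t_i$ estimates the message of $s_i$ by an arbitrary function of what is carried on its incoming edges. The instance is infeasible if, for every such alphabet $\mathcal{X}$, there is no sequence of such codes with $T\to\infty$ for which the probability that some terminal decodes incorrectly tends to $0$ (in particular, there is no zero-error code, linear or nonlinear, for any $T$). *)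

theory Defs
  imports "HOL-Probability.Probability" "Graph_Theory.Digraph"
begin

record ('v, 'e) multiple_unicast =
  network :: "('v, 'e) pre_digraph"
  num_sessions :: nat
  source :: "nat \<Rightarrow> 'v"
  terminal :: "nat \<Rightarrow> 'v"

text \<open>The sessions are numbered \<open>0, \<dots>, num_sessions I - 1\<close>; the values of \<open>source\<close> and
  \<open>terminal\<close> at other indices are irrelevant. Neither function has to be injective, since sources
  (and likewise terminals) may be collocated. Parallel edges are distinct arcs with the same ends.\<close>

definition unicast_instance :: "('v, 'e) multiple_unicast \<Rightarrow> bool" where
  "unicast_instance I \<longleftrightarrow>
     fin_digraph (network I) \<and>
     acyclic (arcs_ends (network I)) \<and>
     (\<forall>i<num_sessions I. source I i \<in> verts (network I) \<and> terminal I i \<in> verts (network I) \<and>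
        in_arcs (network I) (source I i) = {} \<and> out_arcs (network I) (terminal I i) = {})"


subsection \<open>Maximum flow with unit edge capacities\<close>

definition unit_flow :: "('v, 'e) pre_digraph \<Rightarrow> 'v \<Rightarrow> 'v \<Rightarrow> ('e \<Rightarrow> real) \<Rightarrow> bool" where
  "unit_flow G s t f \<longleftrightarrow>
     (\<forall>e\<in>arcs G. 0 \<le> f e \<and> f e \<le> 1) \<and>
     (\<forall>v\<in>verts G - {s, t}. (\<Sum>e\<in>in_arcs G v. f e) = (\<Sum>e\<in>out_arcs G v. f e))"

definition flow_value :: "('v, 'e) pre_digraph \<Rightarrow> 'v \<Rightarrow> ('e \<Rightarrow> real) \<Rightarrow> real" where
  "flow_value G s f = (\<Sum>e\<in>out_arcs G s. f e) - (\<Sum>e\<in>in_arcs G s. f e)"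

text \<open>On a finite graph the set of values of flows is nonempty and bounded above by the number of
  edges, so the real supremum below is not a default value.\<close>

definition max_flow :: "('v, 'e) pre_digraph \<Rightarrow> 'v \<Rightarrow> 'v \<Rightarrow> real" where
  "max_flow G s t = (SUP f\<in>{f. unit_flow G s t f}. flow_value G s f)"

definition connectivity_level :: "('v, 'e) multiple_unicast \<Rightarrow> real list" where
  "connectivity_level I =
     map (\<lambda>i. max_flow (network I) (source I i) (terminal I i)) [0..<num_sessions I]"


subsection \<open>Codes\<close>

definition blocks :: "'x set \<Rightarrow> nat \<Rightarrow> 'x list set" where
  "blocks X T = {b. set b \<subseteq> X \<and> length b = T}"

definition messages :: "('v, 'e) multiple_unicast \<Rightarrow> 'x set \<Rightarrow> nat \<Rightarrow> (nat \<Rightarrow> 'x list) set" where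
  "messages I X T = {..<num_sessions I} \<rightarrow>\<^sub>E blocks X T"

definition message_pmf :: "('v, 'e) multiple_unicast \<Rightarrow> 'x set \<Rightarrow> nat \<Rightarrow> (nat \<Rightarrow> 'x list) pmf" where
  "message_pmf I X T = Pi_pmf {..<num_sessions I} undefined (\<lambda>_. pmf_of_set (blocks X T))"

definition observed_at :: "('v, 'e) multiple_unicast \<Rightarrow> 'v \<Rightarrow> nat set" where
  "observed_at I v = {i. i < num_sessions I \<and> source I i = v}"

text \<open>A code is given by what each edge carries and what each terminal outputs when the vector of
  all messages is \<open>w\<close>. That coding is local is the existence, in \<open>is_code\<close>, of the functions \<open>g\<close>
  and \<open>h\<close>; as the network is acyclic, such local functions in turn determine \<open>carried\<close> and
  \<open>estimate\<close>.\<close>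

record ('e, 'x) code =
  carried :: "'e \<Rightarrow> (nat \<Rightarrow> 'x list) \<Rightarrow> 'x list"
  estimate :: "nat \<Rightarrow> (nat \<Rightarrow> 'x list) \<Rightarrow> 'x list"

definition is_code :: "('v, 'e) multiple_unicast \<Rightarrow> 'x set \<Rightarrow> nat \<Rightarrow> ('e, 'x) code \<Rightarrow> bool" where
  "is_code I X T C \<longleftrightarrow>
     (\<forall>e\<in>arcs (network I).
        (\<forall>w\<in>messages I X T. carried C e w \<in> blocks X T) \<and>
        (\<exists>g. \<forall>w\<in>messages I X T. carried C e w =
           g (\<lambda>a\<in>in_arcs (network I) (tail (network I) e). carried C a w)
             (\<lambda>i\<in>observed_at I (tail (network I) e). w i))) \<and>
     (\<forall>i<num_sessions I.
        (\<forall>w\<in>messages I X T. estimate C i w \<in> blocks X T) \<and>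
        (\<exists>h. \<forall>w\<in>messages I X T. estimate C i w =
           h (\<lambda>a\<in>in_arcs (network I) (terminal I i). carried C a w)))"

definition error_prob :: "('v, 'e) multiple_unicast \<Rightarrow> 'x set \<Rightarrow> nat \<Rightarrow> ('e, 'x) code \<Rightarrow> real" where
  "error_prob I X T C =
     measure_pmf.prob (message_pmf I X T) {w. \<exists>i<num_sessions I. estimate C i w \<noteq> w i}"

definition achievable_over :: "('v, 'e) multiple_unicast \<Rightarrow> 'x set \<Rightarrow> bool" where
  "achievable_over I X \<longleftrightarrow>
     (\<exists>(T :: nat \<Rightarrow> nat) (C :: nat \<Rightarrow> ('e, 'x) code).
        filterlim T at_top sequentially \<and>
        (\<forall>k. is_code I X (T k) (C k)) \<and>
        (\<lambda>k. error_prob I X (T k) (C k)) \<longlonglongrightarrow> 0)"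

text \<open>Every finite alphabet is in bijection with a finite set of natural numbers, so it suffices
  to let the alphabet range over the latter.\<close>

definition infeasible :: "('v, 'e) multiple_unicast \<Rightarrow> bool" where
  "infeasible I \<longleftrightarrow> (\<forall>X :: nat set. finite X \<and> card X \<ge> 2 \<longrightarrow> \<not> achievable_over I X)"

end

(* Unit-entropy sessions whose terminals are collocated at a node v must all be decoded from what
   the arcs into v carry, so they are infeasible as soon as they outnumber these arcs. Since sources
   and terminals may be collocated, this already excludes three sessions over two parallel arcs
   (level [2 2 2]), and two sessions over a single arc next to a separate third session that has
   three parallel arcs to itself (level [1 1 3]). *)
theory Submission
  imports Defs
begin

text \<open>Saturating all arcs out of \<open>s\<close> is a flow: these arcs end at
  \<open>t\<close>, so at any other vertex both sides of conservation are zero. Unit capacities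
  bound every flow value by the number of these arcs, so the supremum is attained.\<close>

lemma max_flow_direct_arcs:
  fixes G :: "('v, 'e) pre_digraph"
  assumes fin: "finite (arcs G)"
    and no_in: "in_arcs G s = {}"
    and direct: "\<And>e. e \<in> out_arcs G s \<Longrightarrow> head G e = t"
  shows "max_flow G s t = real (card (out_arcs G s))"
proof -
  let ?c = "real (card (out_arcs G s))"
  let ?f = "\<lambda>e. if e \<in> out_arcs G s then 1 else 0 :: real"
  have "(\<Sum>e\<in>in_arcs G v. ?f e) = (\<Sum>e\<in>out_arcs G v. ?f e)" if "v \<in> verts G - {s, t}" for v
  proof -
    have "(\<Sum>e\<in>in_arcs G v. ?f e) = 0" "(\<Sum>e\<in>out_arcs G v. ?f e) = 0"
      using that direct by (auto intro!: sum.neutral)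
    then show ?thesis by simp
  qed
  then have flow: "unit_flow G s t ?f"
    unfolding unit_flow_def by auto
  have val: "flow_value G s ?f = ?c"
    by (simp add: flow_value_def no_in)
  have bound: "flow_value G s f \<le> ?c" if "unit_flow G s t f" for f
  proof -
    have "(\<Sum>e\<in>out_arcs G s. f e) \<le> (\<Sum>e\<in>out_arcs G s. 1)"
      using that by (intro sum_mono) (auto simp: unit_flow_def)
    then show ?thesis by (simp add: flow_value_def no_in)
  qed
  show ?thesis
    unfolding max_flow_def
  proof (rule cSup_eq_maximum)
    show "?c \<in> flow_value G s ` {f. unit_flow G s t f}"
      using flow val by (metis (mono_tags, lifting) image_eqI mem_Collect_eq)
  qed (use bound in auto)
qed

lemma finite_blocks: "finite X \<Longrightarrow> finite (blocks X T)"
  by (simp add: blocks_def finite_lists_length_eq)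

lemma card_blocks: "finite X \<Longrightarrow> card (blocks X T) = card X ^ T"
  by (simp add: blocks_def card_lists_length_eq)

text \<open>A product of uniform distributions is uniform on the product set. The default
  \<open>undefined\<close> of \<open>Pi_pmf\<close> is also the value of extensional functions off
  the index set, so both sides live on the same functions. Error probabilities thus become a matter
  of counting.\<close>

lemma message_pmf_eq_uniform:
  assumes "finite X" "X \<noteq> {}"
  shows "message_pmf I X T = pmf_of_set (messages I X T)"
proof -
  have "card (blocks X T) > 0"
    using assms by (simp add: card_blocks card_gt_0_iff)
  then have "blocks X T \<noteq> {}" by auto
  moreover have "PiE_dflt {..<num_sessions I} undefined (\<lambda>_. blocks X T) = messages I X T"
    by (auto simp: PiE_dflt_def messages_def PiE_def extensional_def Pi_def)
  ultimately show ?thesis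
    unfolding message_pmf_def
    by (subst Pi_pmf_of_set) (auto simp: finite_blocks assms)
qed

text \<open>A correctly decoded message vector is determined by what the arcs into \<open>v\<close> carry together
  with the messages of the sessions that do not end at \<open>v\<close>.\<close>

lemma error_prob_collocated_terminals:
  fixes I :: "('v, 'e) multiple_unicast"
  assumes X: "finite X" "card X \<ge> 2"
    and code: "is_code I X T C"
    and fin: "finite (arcs (network I))"
    and J: "J \<subseteq> {..<num_sessions I}" "\<And>i. i \<in> J \<Longrightarrow> terminal I i = v"
    and few: "card (in_arcs (network I) v) < card J"
    and T: "T \<ge> 1"
  shows "error_prob I X T C \<ge> 1 / 2"
proof -
  let ?n = "num_sessions I" and ?A = "in_arcs (network I) v" and ?B = "blocks X T"
  let ?M = "messages I X T"
  define good where "good = {w \<in> ?M. \<forall>i<?n. estimate C i w = w i}"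
  have X0: "X \<noteq> {}" using X by auto
  \<comment> \<open>This is where \<open>T \<ge> 1\<close> enters: for \<open>T = 0\<close> there is
    just one block, and no error can occur.\<close>
  have "card X ^ 1 \<le> card X ^ T"
    using X T by (intro power_increasing) auto
  then have B2: "card ?B \<ge> 2" using X by (simp add: card_blocks)
  have finB: "finite ?B" using X by (simp add: finite_blocks)
  have finA: "finite ?A" using fin by (auto simp: in_arcs_def)
  have finJ: "finite J" using J(1) finite_subset by blast
  have cardJ: "card J \<le> ?n"
    using card_mono[OF _ J(1)] by simp
  have finM: "finite ?M" and cardM: "card ?M = card ?B ^ ?n"
    using finB by (auto simp: messages_def card_PiE intro!: finite_PiE)
  have M0: "?M \<noteq> {}" using cardM B2 by auto
  define \<phi> where "\<phi> w = ((\<lambda>a\<in>?A. carried C a w), (\<lambda>i\<in>{..<?n} - J. w i))" for w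
  have inj: "inj_on \<phi> good"
  proof (rule inj_onI)
    fix w w' assume w: "w \<in> good" and w': "w' \<in> good" and eq: "\<phi> w = \<phi> w'"
    \<comment> \<open>For \<open>i \<in> J\<close> the decoder reads only the first component of
      \<open>\<phi>\<close>, because its terminal is \<open>v\<close>; for other sessions the
      message itself is stored in the second component.\<close>
    have same: "w i = w' i" if i: "i < ?n" for i
    proof (cases "i \<in> J")
      case True
      obtain h where h: "\<And>w. w \<in> ?M \<Longrightarrow> estimate C i w = h (\<lambda>a\<in>?A. carried C a w)"
        using code i J(2)[OF True] unfolding is_code_def by metis
      have "w i = estimate C i w" using w i by (simp add: good_def)
      also have "\<dots> = estimate C i w'"
        using h[of w] h[of w'] w w' eq by (simp add: good_def \<phi>_def)
      also have "\<dots> = w' i" using w' i by (simp add: good_def)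
      finally show ?thesis .
    next
      case False
      then show ?thesis
        using eq i unfolding \<phi>_def by (metis DiffI lessThan_iff prod.inject restrict_apply')
    qed
    show "w = w'"
    proof (rule PiE_ext)
      show "w \<in> {..<?n} \<rightarrow>\<^sub>E ?B" "w' \<in> {..<?n} \<rightarrow>\<^sub>E ?B"
        using w w' by (auto simp: good_def messages_def)
    qed (use same in auto)
  qed
  have sub: "\<phi> ` good \<subseteq> (?A \<rightarrow>\<^sub>E ?B) \<times> (({..<?n} - J) \<rightarrow>\<^sub>E ?B)"
  proof
    fix p assume "p \<in> \<phi> ` good"
    then obtain w where w: "w \<in> ?M" and p: "p = \<phi> w" by (auto simp: good_def)
    have "(\<lambda>a\<in>?A. carried C a w) \<in> ?A \<rightarrow>\<^sub>E ?B"
      using code w by (intro restrict_PiE_iff[THEN iffD2]) (auto simp: is_code_def)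
    moreover have "(\<lambda>i\<in>{..<?n} - J. w i) \<in> ({..<?n} - J) \<rightarrow>\<^sub>E ?B"
      using w by (intro restrict_PiE_iff[THEN iffD2]) (auto simp: messages_def)
    ultimately show "p \<in> (?A \<rightarrow>\<^sub>E ?B) \<times> (({..<?n} - J) \<rightarrow>\<^sub>E ?B)"
      by (simp add: p \<phi>_def)
  qed
  have "card good \<le> card ((?A \<rightarrow>\<^sub>E ?B) \<times> (({..<?n} - J) \<rightarrow>\<^sub>E ?B))"
    using finA finB by (intro card_inj_on_le[OF inj sub]) (auto intro!: finite_PiE)
  also have "\<dots> = card ?B ^ (card ?A + (?n - card J))"
    using finA finJ J(1)
    by (simp add: card_cartesian_product card_PiE card_Diff_subset power_add)
  \<comment> \<open>By \<open>few\<close> the exponent is below \<open>?n\<close>, so a spare factor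
    \<open>card ?B \<ge> 2\<close> absorbs the 2: at most half of all message vectors are decoded
    correctly.\<close>
  finally have "2 * card good \<le> card ?B * card ?B ^ (card ?A + (?n - card J))"
    using B2 by (intro mult_mono) auto
  also have "\<dots> = card ?B ^ Suc (card ?A + (?n - card J))"
    by simp
  also have "\<dots> \<le> card ?B ^ ?n"
    using few cardJ B2 by (intro power_increasing) auto
  finally have half: "2 * card good \<le> card ?M"
    by (simp add: cardM)
  have "?M \<inter> {w. \<exists>i<?n. estimate C i w \<noteq> w i} = ?M - good"
    by (auto simp: good_def)
  then have "error_prob I X T C = real (card (?M - good)) / real (card ?M)"
    unfolding error_prob_def message_pmf_eq_uniform[OF X(1) X0]
    by (simp add: measure_pmf_of_set[OF M0 finM])
  also have "card (?M - good) = card ?M - card good"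
    using finM by (intro card_Diff_subset) (auto simp: good_def intro: finite_subset)
  finally have err: "error_prob I X T C = real (card ?M - card good) / real (card ?M)" .
  have "card ?M > 0" using finM M0 by (simp add: card_gt_0_iff)
  then show ?thesis
    using half unfolding err by (simp add: field_simps of_nat_diff)
qed

text \<open>As \<open>T\<close> tends to infinity, eventually \<open>T k \<ge> 1\<close>; from then
  on the error probability is at least 1/2 and cannot tend to 0.\<close>

lemma infeasible_collocated_terminals:
  fixes I :: "('v, 'e) multiple_unicast"
  assumes "finite (arcs (network I))"
    and "J \<subseteq> {..<num_sessions I}" "\<And>i. i \<in> J \<Longrightarrow> terminal I i = v"
    and "card (in_arcs (network I) v) < card J"
  shows "infeasible I"
  unfolding infeasible_def
proof (intro allI impI notI)
  fix X :: "nat set"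
  assume X: "finite X \<and> card X \<ge> 2" and "achievable_over I X"
  then obtain T and C :: "nat \<Rightarrow> ('e, nat) code" where
    T: "filterlim T at_top sequentially" and
    code: "\<And>k. is_code I X (T k) (C k)" and
    lim: "(\<lambda>k. error_prob I X (T k) (C k)) \<longlonglongrightarrow> 0"
    unfolding achievable_over_def by blast
  have "\<forall>\<^sub>F k in sequentially. T k \<ge> 1"
    using T by (simp add: filterlim_at_top)
  moreover have "\<forall>\<^sub>F k in sequentially. error_prob I X (T k) (C k) < 1 / 2"
    using lim by (rule order_tendstoD) simp
  ultimately have "\<forall>\<^sub>F k in sequentially. False"
  proof eventually_elim
    case (elim k)
    then show False
      using error_prob_collocated_terminals[OF _ _ code assms, of k] X by fastforce
  qed
  \<comment> \<open>A property that holds eventually along \<open>sequentially\<close> holds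
    somewhere, as this filter is nontrivial.\<close>
  then show False by simp
qed

definition instance222 :: "(nat, nat) multiple_unicast" where
  "instance222 =
     \<lparr>network = \<lparr>verts = {0, 1}, arcs = {0, 1}, tail = \<lambda>_. 0, head = \<lambda>_. 1\<rparr>,
      num_sessions = 3, source = \<lambda>_. 0, terminal = \<lambda>_. 1\<rparr>"

text \<open>Arc 0 is the bottleneck shared by sessions 0 and 1; the component on vertices 2 and 3
  only supplies the entry 3 of the connectivity level.\<close>

definition instance113 :: "(nat, nat) multiple_unicast" where
  "instance113 =
     \<lparr>network = \<lparr>verts = {0, 1, 2, 3}, arcs = {0, 1, 2, 3},
        tail = \<lambda>e. if e = 0 then 0 else 2, head = \<lambda>e. if e = 0 then 1 else 3\<rparr>,
      num_sessions = 3,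
      source = \<lambda>i. if i < 2 then 0 else 2, terminal = \<lambda>i. if i < 2 then 1 else 3\<rparr>"

text \<open>The vertex order serves as a topological order: it is well-founded, hence acyclic, and
  so is every subrelation.\<close>

lemma acyclic_increasing_arcs:
  fixes G :: "('v :: wellorder, 'e) pre_digraph"
  assumes "\<And>e. e \<in> arcs G \<Longrightarrow> tail G e < head G e"
  shows "acyclic (arcs_ends G)"
proof (rule acyclic_subset)
  show "acyclic {(x :: 'v, y). x < y}"
    using wf by (rule wf_acyclic)
  show "arcs_ends G \<subseteq> {(x, y). x < y}"
    using assms by (auto simp: arcs_ends_def arc_to_ends_def)
qed

lemma unicast_instance222: "unicast_instance instance222"
  unfolding unicast_instance_def
  by (auto simp: instance222_def in_arcs_def out_arcs_def
      intro!: acyclic_increasing_arcs fin_digraph.intro wf_digraph.intro fin_digraph_axioms.intro)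

lemma unicast_instance113: "unicast_instance instance113"
  unfolding unicast_instance_def
  by (auto simp: instance113_def in_arcs_def out_arcs_def
      intro!: acyclic_increasing_arcs fin_digraph.intro wf_digraph.intro fin_digraph_axioms.intro
      split: if_splits)

lemma connectivity_level222: "connectivity_level instance222 = [2, 2, 2]"
proof -
  have "out_arcs (network instance222) 0 = {0, 1}"
    by (auto simp: instance222_def out_arcs_def)
  moreover have "max_flow (network instance222) 0 1 = card (out_arcs (network instance222) 0)"
    by (rule max_flow_direct_arcs) (auto simp: instance222_def in_arcs_def)
  ultimately show ?thesis
    by (simp add: connectivity_level_def instance222_def upt_rec)
qed

lemma connectivity_level113: "connectivity_level instance113 = [1, 1, 3]"
proof -
  have "out_arcs (network instance113) 0 = {0}" "out_arcs (network instance113) 2 = {1, 2, 3}"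
    by (auto simp: instance113_def out_arcs_def split: if_splits)
  moreover have "max_flow (network instance113) 0 1 = card (out_arcs (network instance113) 0)"
    by (rule max_flow_direct_arcs) (auto simp: instance113_def in_arcs_def split: if_splits)
  moreover have "max_flow (network instance113) 2 3 = card (out_arcs (network instance113) 2)"
    by (rule max_flow_direct_arcs) (auto simp: instance113_def in_arcs_def split: if_splits)
  ultimately show ?thesis
    by (simp add: connectivity_level_def instance113_def upt_rec)
qed

lemma infeasible222: "infeasible instance222"
proof (rule infeasible_collocated_terminals)
  have "in_arcs (network instance222) 1 = {0, 1}"
    by (auto simp: instance222_def in_arcs_def)
  \<comment> \<open>This choice sets \<open>J\<close> to all three sessions, which end at vertex 1
    behind two arcs.\<close>
  then show "card (in_arcs (network instance222) 1) < card {..<3 :: nat}"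
    by simp
qed (auto simp: instance222_def)

lemma infeasible113: "infeasible instance113"
proof (rule infeasible_collocated_terminals)
  have "in_arcs (network instance113) 1 = {0}"
    by (auto simp: instance113_def in_arcs_def split: if_splits)
  \<comment> \<open>Here \<open>J\<close> consists of sessions 0 and 1 only, which end at vertex 1
    behind a single arc.\<close>
  then show "card (in_arcs (network instance113) 1) < card {..<2 :: nat}"
    by simp
qed (auto simp: instance113_def)

theorem mainTheorem2:
  shows "(\<exists>I :: (nat, nat) multiple_unicast.
            unicast_instance I \<and> num_sessions I = 3 \<and>
            connectivity_level I = [2, 2, 2] \<and> infeasible I) \<and>
         (\<exists>I :: (nat, nat) multiple_unicast.
            unicast_instance I \<and> num_sessions I = 3 \<and>
            connectivity_level I = [1, 1, 3] \<and> infeasible I)"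
proof (intro conjI exI)
  show "num_sessions instance222 = 3" "num_sessions instance113 = 3"
    by (simp_all add: instance222_def instance113_def)
qed (fact unicast_instance222 connectivity_level222 infeasible222
      unicast_instance113 connectivity_level113 infeasible113)+

end
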